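(* Let $K:X\to Y$ be a linear, compact and injective operator between infinite-dimensional separable real Hilbert spaces, let $\{\phi_i\}_{i=1}^\infty$ be an orthonormal basis of $X$, let $k\ge1$, $\tau>0$, $\alpha>0$, and let $K_k$ and $\mathcal{R}_{W_k}$ be as defined in the context. Let $x^\dagger\in X$, $y=Kx^\dagger$, and let $y^\delta\in Y$ satisfy $\|y-y^\delta\|\le\delta$. Let $$x_{k,\alpha}\in\operatorname*{arg\,min}_{x\in X}\left\{\frac12\|K_kx-y^\delta\|^2+\alpha\,\mathcal{R}_{W_k}(x)\right\}.$$ Assume that the source condition holds: there is $\lambda_k\in Y$ with $K_k^*\lambda_k\in\partial\mathcal{R}_{W_k}(x^\dagger)$. Then the Bregman distance $$d_k=\mathcal{R}_{W_k}(x_{k,\alpha})-\mathcal{R}_{W_k}(x^\dagger)-\left(K_k^*\lambda_k,\,x_{k,\alpha}-x^\dagger\right)$$ satisfies $$d_k\le\frac{(\sigma_{k+1}\|x^\dagger\|+\delta)^2}{2\alpha}+\|\lambda_k\|\,(\delta+\sigma_{k+1}\|x^\dagger\|)+\frac{\alpha}{2}\|\lambda_k\|^2.$$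
   Context: $(\cdot,\cdot)$ and $\|\cdot\|$ denote the inner product and norm of $X$ or $Y$, according to context. Let $(v_i,u_i;\sigma_i)_{i\ge1}$ be a singular system of $K$, so that $Kx=\sum_{i=1}^\infty\sigma_i(x,v_i)u_i$ with $\sigma_1\ge\sigma_2\ge\cdots>0$, where $\{v_i\}$ is an orthonormal basis of $X$ ($K$ being injective) and $\{u_i\}$ is orthonormal in $Y$. The truncated operator is $K_kx=\sum_{i=1}^k\sigma_i(x,v_i)u_i$, with adjoint $K_k^*$, and $P_k$ is the orthogonal projection of $X$ onto $\mathcal{N}(K_k)^\perp=\mathrm{span}\{v_1,\ldots,v_k\}$. Given a threshold $\tau>0$, the weights are $w_{k,i}=\|P_k\phi_i\|$ if $\|P_k\phi_i\|\ge\tau$ and $w_{k,i}=\tau$ if $\|P_k\phi_i\|<\tau$. The functional $\mathcal{R}_{W_k}:X\to[0,\infty]$ is $\mathcal{R}_{W_k}(x)=\sum_{i=1}^\infty w_{k,i}|(x,\phi_i)|$, and $\partial\mathcal{R}_{W_k}$ denotes its convex subdifferential (empty at points where $\mathcal{R}_{W_k}=+\infty$). *)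

theory Defs
  imports "HOL-Analysis.Analysis"
begin

(* Families written (f_i), i >= 1, are functions nat => _ of which only the values at
   indices >= 1 are ever used; a series over i >= 1 is therefore written with Suc i. *)

definition orthonormal_family :: "(nat \<Rightarrow> 'a::real_inner) \<Rightarrow> bool" where
  "orthonormal_family f \<longleftrightarrow> (\<forall>i\<ge>1. \<forall>j\<ge>1. f i \<bullet> f j = (if i = j then 1 else 0))"

definition orthonormal_basis :: "(nat \<Rightarrow> 'a::real_inner) \<Rightarrow> bool" where
  "orthonormal_basis f \<longleftrightarrow> orthonormal_family f \<and> closure (span (f ` {1..})) = UNIV"

definition infinite_dimensional :: "'a::real_vector set \<Rightarrow> bool" where
  "infinite_dimensional S \<longleftrightarrow> \<not> (\<exists>B. finite B \<and> S \<subseteq> span B)"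

definition compact_operator :: "('a::real_normed_vector \<Rightarrow> 'b::real_normed_vector) \<Rightarrow> bool" where
  "compact_operator K \<longleftrightarrow> linear K \<and> (\<forall>S. bounded S \<longrightarrow> compact (closure (K ` S)))"

(* Singular system of an injective operator: there is no kernel, so (v_i) is a basis of
   the whole domain; (u_i) need only span the closure of the range. *)
definition singular_system ::
  "('a::real_inner \<Rightarrow> 'b::real_inner) \<Rightarrow> (nat \<Rightarrow> 'a) \<Rightarrow> (nat \<Rightarrow> 'b) \<Rightarrow> (nat \<Rightarrow> real) \<Rightarrow> bool" where
  "singular_system K v u \<sigma> \<longleftrightarrow>
     orthonormal_basis v \<and> orthonormal_family u \<and>
     (\<forall>i\<ge>1. \<sigma> i > 0 \<and> \<sigma> (Suc i) \<le> \<sigma> i) \<and>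
     (\<forall>x. (\<lambda>i. (\<sigma> (Suc i) * (x \<bullet> v (Suc i))) *\<^sub>R u (Suc i)) sums K x)"

definition truncated_operator ::
  "(nat \<Rightarrow> 'a::real_inner) \<Rightarrow> (nat \<Rightarrow> 'b::real_inner) \<Rightarrow> (nat \<Rightarrow> real) \<Rightarrow> nat \<Rightarrow> 'a \<Rightarrow> 'b" where
  "truncated_operator v u \<sigma> k x = (\<Sum>i=1..k. (\<sigma> i * (x \<bullet> v i)) *\<^sub>R u i)"

(* Meaningful for subspaces on which the projection exists (e.g. closed subspaces of a
   Hilbert space); the library's closest_point is restricted to Heine-Borel spaces. *)
definition orthogonal_projection :: "'a::real_inner set \<Rightarrow> 'a \<Rightarrow> 'a" where
  "orthogonal_projection S x = (THE p. p \<in> S \<and> x - p \<in> orthogonal_comp S)"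

(* In the next two definitions the first argument A plays the role of K_k, and the
   projection is onto the orthogonal complement of its null space. *)
definition weight ::
  "('a::real_inner \<Rightarrow> 'b::real_inner) \<Rightarrow> real \<Rightarrow> (nat \<Rightarrow> 'a) \<Rightarrow> nat \<Rightarrow> real" where
  "weight A \<tau> \<phi> i =
     (let p = norm (orthogonal_projection (orthogonal_comp {x. A x = 0}) (\<phi> i))
      in if p \<ge> \<tau> then p else \<tau>)"

definition weighted_l1 ::
  "('a::real_inner \<Rightarrow> 'b::real_inner) \<Rightarrow> real \<Rightarrow> (nat \<Rightarrow> 'a) \<Rightarrow> 'a \<Rightarrow> ereal" where
  "weighted_l1 A \<tau> \<phi> x = (\<Sum>i. ereal (weight A \<tau> \<phi> (Suc i) * \<bar>x \<bullet> \<phi> (Suc i)\<bar>))"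

definition subdifferential :: "('a::real_inner \<Rightarrow> ereal) \<Rightarrow> 'a \<Rightarrow> 'a set" where
  "subdifferential f x =
     {\<xi>. \<bar>f x\<bar> \<noteq> \<infinity> \<and> (\<forall>z. f z \<ge> f x + ereal (\<xi> \<bullet> (z - x)))}"

(* With ereal subtraction an infinite value at z makes the distance infinite, so an upper
   bound on it is never met by a truncated or arbitrary value. *)
definition bregman_distance :: "('a::real_inner \<Rightarrow> ereal) \<Rightarrow> 'a \<Rightarrow> 'a \<Rightarrow> 'a \<Rightarrow> ereal" where
  "bregman_distance f \<xi> z x = f z - f x - ereal (\<xi> \<bullet> (z - x))"

end

theory Submission
  imports Defs
begin

text \<open>
  Comparing the values of the functional at the minimizer and at the exact solution bounds the
  difference of the penalties by the difference of the squared residuals. The source condition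
  turns the linear term of the Bregman distance into an inner product of \<open>\<mu>\<^sub>k\<close> with the difference
  of the two residuals, and Young's inequality absorbs the unknown residual of the minimizer.
  The residual of the exact solution is the noise plus the truncation error, which Bessel's
  inequality bounds by \<open>\<sigma> (k + 1) * norm x\<^sub>d\<close>.
\<close>

lemma norm_sum_orthonormal:
  assumes "orthonormal_family u" and "finite I" and "I \<subseteq> {1..}"
  shows "(norm (\<Sum>i\<in>I. c i *\<^sub>R u i))\<^sup>2 = (\<Sum>i\<in>I. (c i)\<^sup>2)"
proof -
  have uu: "u i \<bullet> u j = (if i = j then 1 else 0)" if "i \<in> I" "j \<in> I" for i j
    using that assms unfolding orthonormal_family_def by (metis atLeast_iff subsetD)
  have "(norm (\<Sum>i\<in>I. c i *\<^sub>R u i))\<^sup>2 = (\<Sum>i\<in>I. (norm (c i *\<^sub>R u i))\<^sup>2)"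
    using assms(2) uu by (intro norm_sum_Pythagorean) (auto simp: pairwise_def orthogonal_def)
  also have "\<dots> = (\<Sum>i\<in>I. (c i)\<^sup>2)"
    by (intro sum.cong) (auto simp: power_mult_distrib power2_norm_eq_inner uu)
  finally show ?thesis .
qed

text \<open>The squared distance from \<open>x\<close> to its projection \<open>?p\<close> is
  nonnegative; by orthonormality both \<open>x \<bullet> ?p\<close> and the squared norm of
  \<open>?p\<close> equal the sum on the left.\<close>

lemma bessel_inequality:
  assumes "orthonormal_family v" and "finite I" and "I \<subseteq> {1..}"
  shows "(\<Sum>i\<in>I. (x \<bullet> v i)\<^sup>2) \<le> (norm x)\<^sup>2"
proof -
  let ?p = "\<Sum>i\<in>I. (x \<bullet> v i) *\<^sub>R v i"
  have "0 \<le> (norm (x - ?p))\<^sup>2"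
    by simp
  also have "\<dots> = (norm x)\<^sup>2 - 2 * (x \<bullet> ?p) + (norm ?p)\<^sup>2"
    by (simp add: power2_norm_eq_inner inner_diff_left inner_diff_right inner_commute)
  also have "\<dots> = (norm x)\<^sup>2 - (\<Sum>i\<in>I. (x \<bullet> v i)\<^sup>2)"
    unfolding norm_sum_orthonormal[OF assms]
    by (simp add: inner_sum_right power2_eq_square)
  finally show ?thesis
    by simp
qed

text \<open>\<open>adjoint\<close> is defined by choice, so its defining identity needs a witness;
  here an explicit finite sum with \<open>u\<close> and \<open>v\<close> exchanged provides
  it.\<close>

lemma adjoint_truncated_operator:
  "x \<bullet> adjoint (truncated_operator v u \<sigma> k) \<mu> = truncated_operator v u \<sigma> k x \<bullet> \<mu>"
proof -
  have "adjoint (truncated_operator v u \<sigma> k) = (\<lambda>\<mu>. \<Sum>i=1..k. (\<sigma> i * (\<mu> \<bullet> u i)) *\<^sub>R v i)"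
    by (rule adjoint_unique)
      (auto simp: truncated_operator_def inner_sum_left inner_sum_right inner_commute mult_ac
        intro!: sum.cong)
  then show ?thesis
    by (simp add: truncated_operator_def inner_sum_left inner_sum_right inner_commute mult_ac)
qed

lemma truncated_operator_diff:
  "truncated_operator v u \<sigma> k (x - z) =
     truncated_operator v u \<sigma> k x - truncated_operator v u \<sigma> k z"
  by (simp add: truncated_operator_def inner_diff_left right_diff_distrib scaleR_diff_left
      sum_subtractf)

lemma singular_values_antimono:
  assumes "singular_system K v u \<sigma>" and "1 \<le> i" and "i \<le> j"
  shows "\<sigma> j \<le> \<sigma> i"
  using assms(3,2,1)
  by (induction rule: dec_induct) (auto simp: singular_system_def intro: order_trans)

text \<open>The bound holds with \<open>K\<close> replaced by any longer truncation, uniformly in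
  its length \<open>n\<close>, and so passes to the limit.\<close>

lemma norm_truncation_error_le:
  assumes ss: "singular_system K v u \<sigma>"
  shows "norm (K x - truncated_operator v u \<sigma> k x) \<le> \<sigma> (k + 1) * norm x"
proof -
  have pos: "0 < \<sigma> i" if "i \<ge> 1" for i
    using ss that by (auto simp: singular_system_def)
  have v: "orthonormal_family v" and u: "orthonormal_family u"
    using ss by (auto simp: singular_system_def orthonormal_basis_def)
  \<comment> \<open>After shifting the index by one, the partial sums of the singular expansion are
    the truncated operators themselves.\<close>
  have "(\<lambda>n. truncated_operator v u \<sigma> n x) \<longlonglongrightarrow> K x"
    using ss unfolding singular_system_def sums_def truncated_operator_def
    by (simp add: sum.atLeast1_atMost_eq)
  then have "(\<lambda>n. norm (truncated_operator v u \<sigma> n x - truncated_operator v u \<sigma> k x))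
      \<longlonglongrightarrow> norm (K x - truncated_operator v u \<sigma> k x)"
    by (intro tendsto_intros)
  moreover have "norm (truncated_operator v u \<sigma> n x - truncated_operator v u \<sigma> k x)
      \<le> \<sigma> (k + 1) * norm x" if "n \<ge> k" for n
  proof (rule power2_le_imp_le)
    have "truncated_operator v u \<sigma> n x - truncated_operator v u \<sigma> k x
        = (\<Sum>i\<in>{1..n} - {1..k}. (\<sigma> i * (x \<bullet> v i)) *\<^sub>R u i)"
      unfolding truncated_operator_def using that by (subst sum_diff) auto
    also have "{1..n} - {1..k} = {k + 1..n}"
      by auto
    also have "(norm (\<Sum>i\<in>{k + 1..n}. (\<sigma> i * (x \<bullet> v i)) *\<^sub>R u i))\<^sup>2
        = (\<Sum>i\<in>{k + 1..n}. (\<sigma> i * (x \<bullet> v i))\<^sup>2)"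
      by (intro norm_sum_orthonormal u) auto
    \<comment> \<open>The tail starts at \<open>k + 1\<close>, where the decreasing singular values
      are largest; positivity carries the comparison over to squares.\<close>
    also have "\<dots> \<le> (\<Sum>i\<in>{k + 1..n}. (\<sigma> (k + 1))\<^sup>2 * (x \<bullet> v i)\<^sup>2)"
      unfolding power_mult_distrib
      by (intro sum_mono mult_right_mono power_mono singular_values_antimono[OF ss])
        (auto intro!: less_imp_le[OF pos])
    also have "\<dots> \<le> (\<sigma> (k + 1))\<^sup>2 * (norm x)\<^sup>2"
      unfolding sum_distrib_left[symmetric]
      by (intro mult_left_mono bessel_inequality v) auto
    finally show "(norm (truncated_operator v u \<sigma> n x - truncated_operator v u \<sigma> k x))\<^sup>2
        \<le> (\<sigma> (k + 1) * norm x)\<^sup>2"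
      by (simp add: power_mult_distrib)
    show "0 \<le> \<sigma> (k + 1) * norm x"
      using pos[of "k + 1"] by simp
  qed
  ultimately show ?thesis
    by (intro LIMSEQ_le_const2) auto
qed

text \<open>Here \<open>a\<close> and \<open>b\<close> stand for the residuals of the minimizer and
  of the exact solution. Only \<open>b\<close> has an a priori bound, so every term in
  \<open>a\<close> must cancel.\<close>

lemma residual_difference_le:
  fixes a b \<mu> :: "'b::real_inner"
  assumes "\<alpha> > 0" and "norm b \<le> E"
  shows "((norm b)\<^sup>2 - (norm a)\<^sup>2) / (2 * \<alpha>) - \<mu> \<bullet> (a - b)
    \<le> E\<^sup>2 / (2 * \<alpha>) + norm \<mu> * E + \<alpha> / 2 * (norm \<mu>)\<^sup>2"
proof -
  \<comment> \<open>Young's inequality, scaled so that its quadratic term in \<open>norm a\<close>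
    is exactly the one subtracted in the goal.\<close>
  have "0 \<le> (norm a - \<alpha> * norm \<mu>)\<^sup>2 / (2 * \<alpha>)"
    using assms(1) by simp
  also have "\<dots> = (norm a)\<^sup>2 / (2 * \<alpha>) - norm \<mu> * norm a + \<alpha> / 2 * (norm \<mu>)\<^sup>2"
    using assms(1) by (simp add: field_simps power2_eq_square)
  finally have "norm \<mu> * norm a \<le> (norm a)\<^sup>2 / (2 * \<alpha>) + \<alpha> / 2 * (norm \<mu>)\<^sup>2"
    by simp
  moreover have "- (\<mu> \<bullet> (a - b)) \<le> norm \<mu> * norm a + norm \<mu> * norm b"
    using norm_cauchy_schwarz[of \<mu> "- a"] norm_cauchy_schwarz[of \<mu> b]
    by (simp add: inner_diff_right)
  moreover have "norm \<mu> * norm b \<le> norm \<mu> * E"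
    using assms(2) by (intro mult_left_mono) auto
  moreover have "(norm b)\<^sup>2 / (2 * \<alpha>) \<le> E\<^sup>2 / (2 * \<alpha>)"
    using assms by (intro divide_right_mono power_mono) auto
  ultimately show ?thesis
    by (simp add: diff_divide_distrib)
qed

theorem proposition3p8:
  fixes K :: "'a::{real_inner, polish_space} \<Rightarrow> 'b::{real_inner, polish_space}"
    and v \<phi> :: "nat \<Rightarrow> 'a" and u :: "nat \<Rightarrow> 'b" and \<sigma> :: "nat \<Rightarrow> real"
    and k :: nat and \<tau> \<alpha> \<delta> :: real
    and K\<^sub>k :: "'a \<Rightarrow> 'b" and R :: "'a \<Rightarrow> ereal"
    and x\<^sub>d x\<^sub>\<alpha> :: 'a and y y\<^sub>\<delta> \<mu>\<^sub>k :: 'b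
  assumes "infinite_dimensional (UNIV :: 'a set)"
    and "infinite_dimensional (UNIV :: 'b set)"
    and "compact_operator K" and "inj K"
    and "singular_system K v u \<sigma>"
    and "orthonormal_basis \<phi>"
    and "k \<ge> 1" and "\<tau> > 0" and "\<alpha> > 0"
    and "K\<^sub>k = truncated_operator v u \<sigma> k"
    and "R = weighted_l1 K\<^sub>k \<tau> \<phi>"
    and "y = K x\<^sub>d" and "norm (y - y\<^sub>\<delta>) \<le> \<delta>"
    and "is_arg_min (\<lambda>x. ereal (1/2 * (norm (K\<^sub>k x - y\<^sub>\<delta>))\<^sup>2) + ereal \<alpha> * R x)
           (\<lambda>_. True) x\<^sub>\<alpha>"
    and "adjoint K\<^sub>k \<mu>\<^sub>k \<in> subdifferential R x\<^sub>d"
  shows "bregman_distance R (adjoint K\<^sub>k \<mu>\<^sub>k) x\<^sub>\<alpha> x\<^sub>d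
           \<le> ereal ((\<sigma> (k + 1) * norm x\<^sub>d + \<delta>)\<^sup>2 / (2 * \<alpha>)
               + norm \<mu>\<^sub>k * (\<delta> + \<sigma> (k + 1) * norm x\<^sub>d)
               + \<alpha> / 2 * (norm \<mu>\<^sub>k)\<^sup>2)"
proof -
  note ss = assms(5) and \<alpha> = assms(9) and K\<^sub>k = assms(10)
  let ?a = "K\<^sub>k x\<^sub>\<alpha> - y\<^sub>\<delta>" and ?b = "K\<^sub>k x\<^sub>d - y\<^sub>\<delta>"
  let ?E = "\<sigma> (k + 1) * norm x\<^sub>d + \<delta>" and ?\<xi> = "adjoint K\<^sub>k \<mu>\<^sub>k"
  \<comment> \<open>\<open>?b\<close> is the noise \<open>y - y\<^sub>\<delta>\<close> minus the
    truncation error.\<close>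
  have "norm ?b \<le> norm (K x\<^sub>d - K\<^sub>k x\<^sub>d) + norm (y - y\<^sub>\<delta>)"
    using norm_triangle_ineq4[of "y - y\<^sub>\<delta>" "K x\<^sub>d - K\<^sub>k x\<^sub>d"] \<open>y = K x\<^sub>d\<close> by simp
  then have b: "norm ?b \<le> ?E"
    using norm_truncation_error_le[OF ss, of x\<^sub>d k] assms(13) unfolding K\<^sub>k by linarith
  have "?\<xi> \<bullet> (x\<^sub>\<alpha> - x\<^sub>d) = (K\<^sub>k x\<^sub>\<alpha> - K\<^sub>k x\<^sub>d) \<bullet> \<mu>\<^sub>k"
    unfolding K\<^sub>k by (simp add: inner_commute[of "adjoint _ _"] adjoint_truncated_operator
        truncated_operator_diff)
  \<comment> \<open>The data \<open>y\<^sub>\<delta>\<close> cancel in the difference of the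
    residuals.\<close>
  then have \<xi>: "?\<xi> \<bullet> (x\<^sub>\<alpha> - x\<^sub>d) = \<mu>\<^sub>k \<bullet> (?a - ?b)"
    by (simp add: inner_commute)
  have fin: "\<bar>R x\<^sub>d\<bar> \<noteq> \<infinity>" and sub: "R x\<^sub>\<alpha> \<ge> R x\<^sub>d + ereal (?\<xi> \<bullet> (x\<^sub>\<alpha> - x\<^sub>d))"
    using assms(15) by (auto simp: subdifferential_def)
  then obtain r where r: "R x\<^sub>d = ereal r"
    by auto
  have min: "ereal (1/2 * (norm ?a)\<^sup>2) + ereal \<alpha> * R x\<^sub>\<alpha> \<le> ereal (1/2 * (norm ?b)\<^sup>2 + \<alpha> * r)"
    using assms(14) r unfolding is_arg_min_def not_less
    by (metis not_less plus_ereal.simps(1) times_ereal.simps(1))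
  \<comment> \<open>The subgradient inequality excludes the value minus infinity;
    \<open>min\<close>, with its real right-hand side and \<alpha> positive, excludes plus infinity.
    The rest is real arithmetic.\<close>
  obtain s where s: "R x\<^sub>\<alpha> = ereal s"
    using min sub r \<alpha> by (cases "R x\<^sub>\<alpha>") auto
  have "\<alpha> * (s - r) \<le> ((norm ?b)\<^sup>2 - (norm ?a)\<^sup>2) / 2"
    using min s by (simp add: algebra_simps)
  then have "s - r \<le> ((norm ?b)\<^sup>2 - (norm ?a)\<^sup>2) / (2 * \<alpha>)"
    using \<alpha> by (simp add: field_simps)
  then have "s - r - ?\<xi> \<bullet> (x\<^sub>\<alpha> - x\<^sub>d)
      \<le> ?E\<^sup>2 / (2 * \<alpha>) + norm \<mu>\<^sub>k * ?E + \<alpha> / 2 * (norm \<mu>\<^sub>k)\<^sup>2"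
    using residual_difference_le[OF \<alpha> b, of ?a \<mu>\<^sub>k] unfolding \<xi> by linarith
  then show ?thesis
    by (simp add: bregman_distance_def r s add.commute)
qed

end
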